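(* For every $s\ge2$ and every finite linear $P_4^s$-free $s$-uniform hypergraph $H$, $$|E(H)|\le\frac{s+1}{s}|V(H)|.$$ Equality holds if and only if $H$ has no isolated vertices and its edge-containing components are vertex-disjoint copies of $S(2,s,s^2)$.
   Context: A hypergraph is $s$-uniform if every edge has exactly $s$ vertices, and linear if any two distinct edges share at most one vertex. $P_4^s$ denotes the linear $s$-uniform hypergraph with four edges whose line graph (vertices are the edges, adjacency is intersection) is a path on four vertices, i.e. consecutive edges meet in exactly one vertex and nonconsecutive edges are disjoint. $H$ is $P_4^s$-free if no four of its edges form a copy of $P_4^s$. A Steiner system $S(2,s,s^2)$ is a hypergraph on $s^2$ points with blocks of size $s$ such that every pair of distinct points lies in exactly one block. *)

theory Defs
  imports Complex_Main
begin

text \<open>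
  A hypergraph is given by its vertex set \<open>V\<close> and its set of edges \<open>E\<close>, each edge being a
  set of vertices; there are no repeated edges.
\<close>

definition hypergraph :: "'a set \<Rightarrow> 'a set set \<Rightarrow> bool" where
  "hypergraph V E \<longleftrightarrow> (\<forall>e\<in>E. e \<subseteq> V)"

definition uniform :: "nat \<Rightarrow> 'a set set \<Rightarrow> bool" where
  "uniform s E \<longleftrightarrow> (\<forall>e\<in>E. finite e \<and> card e = s)"

definition linear_hypergraph :: "'a set set \<Rightarrow> bool" where
  "linear_hypergraph E \<longleftrightarrow> (\<forall>e\<in>E. \<forall>f\<in>E. e \<noteq> f \<longrightarrow> card (e \<inter> f) \<le> 1)"

text \<open>
  The edge set \<open>F\<close> is a copy of $P_4^s$. Linearity of \<open>F\<close> is a consequence of the intersection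
  conditions.
\<close>

definition is_P4 :: "nat \<Rightarrow> 'a set set \<Rightarrow> bool" where
  "is_P4 s F \<longleftrightarrow> uniform s F \<and>
     (\<exists>e1 e2 e3 e4. F = {e1, e2, e3, e4} \<and> distinct [e1, e2, e3, e4] \<and>
        card (e1 \<inter> e2) = 1 \<and> card (e2 \<inter> e3) = 1 \<and> card (e3 \<inter> e4) = 1 \<and>
        e1 \<inter> e3 = {} \<and> e1 \<inter> e4 = {} \<and> e2 \<inter> e4 = {})"

definition P4_free :: "nat \<Rightarrow> 'a set set \<Rightarrow> bool" where
  "P4_free s E \<longleftrightarrow> \<not> (\<exists>F\<subseteq>E. is_P4 s F)"

definition steiner_system_2 :: "nat \<Rightarrow> nat \<Rightarrow> 'a set \<Rightarrow> 'a set set \<Rightarrow> bool" where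
  "steiner_system_2 k n P B \<longleftrightarrow>
     finite P \<and> card P = n \<and> hypergraph P B \<and> uniform k B \<and>
     (\<forall>x\<in>P. \<forall>y\<in>P. x \<noteq> y \<longrightarrow> (\<exists>!b. b \<in> B \<and> x \<in> b \<and> y \<in> b))"

definition isolated_vertex :: "'a set \<Rightarrow> 'a set set \<Rightarrow> 'a \<Rightarrow> bool" where
  "isolated_vertex V E x \<longleftrightarrow> x \<in> V \<and> (\<forall>e\<in>E. x \<notin> e)"

definition share_edge :: "'a set set \<Rightarrow> ('a \<times> 'a) set" where
  "share_edge E = {(x, y). \<exists>e\<in>E. x \<in> e \<and> y \<in> e}"

text \<open>
  Components are represented by their vertex sets; an isolated vertex forms a component without
  edges.
\<close>

definition components :: "'a set \<Rightarrow> 'a set set \<Rightarrow> 'a set set" where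
  "components V E = (\<lambda>x. {y \<in> V. (x, y) \<in> (share_edge E)\<^sup>*}) ` V"

definition edges_within :: "'a set set \<Rightarrow> 'a set \<Rightarrow> 'a set set" where
  "edges_within E C = {e \<in> E. e \<subseteq> C}"

definition edge_components :: "'a set \<Rightarrow> 'a set set \<Rightarrow> 'a set set" where
  "edge_components V E = {C \<in> components V E. edges_within E C \<noteq> {}}"

end

theory Submission
  imports Defs "HOL-Library.Disjoint_Sets"
begin

text \<open>
  The line graph contains no induced path on four vertices, so in a component whose edges do not
  pairwise intersect, some nonempty edge set \<open>S\<close> meets every remaining edge, while the remaining
  edges fall into two vertex-disjoint parts. Each part is a module of the line graph whose outer
  neighbourhood also meets an edge disjoint from it, and induction over such modules bounds the
  degree sum over the vertices of the part by \<open>s + 1\<close> per vertex. A vertex outside both parts has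
  degree at most \<open>s\<close>, because all edges through it meet one edge avoiding it. Summing degrees gives
  the bound; equality forces the two parts together to be a perfect matching of \<open>s\<close> edges, and
  counting pairs turns the component into \<open>S(2, s, s\<^sup>2)\<close>.
\<close>

definition deg :: "'a set set \<Rightarrow> 'a \<Rightarrow> nat" where
  "deg F v = card {f \<in> F. v \<in> f}"

definition disconnected :: "'a set set \<Rightarrow> bool" where
  "disconnected D \<longleftrightarrow>
     (\<exists>P Q. P \<noteq> {} \<and> Q \<noteq> {} \<and> D = P \<union> Q \<and> (\<forall>p\<in>P. \<forall>q\<in>Q. p \<inter> q = {}))"

lemma disconnectedI:
  assumes "P \<noteq> {}" "Q \<noteq> {}" "D = P \<union> Q" "\<And>p q. p \<in> P \<Longrightarrow> q \<in> Q \<Longrightarrow> p \<inter> q = {}"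
  shows "disconnected D"
  unfolding disconnected_def by (rule exI[of _ P], rule exI[of _ Q]) (intro conjI ballI assms)

lemma disconnectedE:
  assumes "disconnected D"
  obtains P Q where "P \<noteq> {}" "Q \<noteq> {}" "D = P \<union> Q" "\<And>p q. p \<in> P \<Longrightarrow> q \<in> Q \<Longrightarrow> p \<inter> q = {}"
proof -
  from assms obtain P Q where "P \<noteq> {}" "Q \<noteq> {}" "D = P \<union> Q"
    and "\<forall>p\<in>P. \<forall>q\<in>Q. p \<inter> q = {}"
    unfolding disconnected_def by (elim exE conjE) (rule that)
  then show thesis by (intro that[of P Q]) simp_all
qed

lemma sum_deg:
  assumes "finite W" "finite F"
  shows "(\<Sum>v\<in>W. deg F v) = (\<Sum>f\<in>F. card (f \<inter> W))"
proof -
  have "(\<Sum>v\<in>W. deg F v) = (\<Sum>v\<in>W. \<Sum>f\<in>F. if v \<in> f then 1 else 0)"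
    unfolding deg_def using assms by (intro sum.cong refl) (simp flip: sum.inter_filter)
  also have "\<dots> = (\<Sum>f\<in>F. \<Sum>v\<in>W. if v \<in> f then 1 else 0)"
    by (rule sum.swap)
  also have "\<dots> = (\<Sum>f\<in>F. card (f \<inter> W))"
  proof (intro sum.cong refl)
    fix f
    have "f \<inter> W = {v \<in> W. v \<in> f}" by auto
    then show "(\<Sum>v\<in>W. if v \<in> f then 1 else 0) = card (f \<inter> W)"
      using assms by (simp flip: sum.inter_filter)
  qed
  finally show ?thesis .
qed

lemma deg_mono:
  assumes "finite G" "F \<subseteq> G"
  shows "deg F v \<le> deg G v"
  unfolding deg_def using assms by (intro card_mono) auto

lemma card_offdiag:
  assumes "finite A"
  shows "card (A \<times> A - Id_on A) = card A * (card A - 1)"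
proof -
  have Id: "Id_on A = (\<lambda>x. (x, x)) ` A" by auto
  then have "card (Id_on A) = card A" by (simp add: card_image inj_on_def)
  moreover have "finite (Id_on A)" "Id_on A \<subseteq> A \<times> A" using assms Id by auto
  ultimately show ?thesis
    by (simp add: card_Diff_subset card_cartesian_product diff_mult_distrib2)
qed

locale linear_uniform =
  fixes s :: nat and E :: "'a set set"
  assumes s2: "s \<ge> 2"
    and finite_E: "finite E"
    and unif: "uniform s E"
    and lin: "linear_hypergraph E"
begin

lemma finite_edge: "e \<in> E \<Longrightarrow> finite e"
  and card_edge: "e \<in> E \<Longrightarrow> card e = s"
  using unif by (auto simp: uniform_def)

lemma edge_nonempty: "e \<in> E \<Longrightarrow> e \<noteq> {}"
  using card_edge s2 by fastforce

lemma finite_Union: "D \<subseteq> E \<Longrightarrow> finite (\<Union>D)"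
  using finite_E finite_edge by (meson finite_Union finite_subset subsetD)

lemma edge_eqI:
  assumes "e \<in> E" "f \<in> E" "u \<in> e" "v \<in> e" "u \<in> f" "v \<in> f" "u \<noteq> v"
  shows "e = f"
proof (rule ccontr)
  assume "e \<noteq> f"
  then have "card (e \<inter> f) \<le> 1"
    using lin assms by (auto simp: linear_hypergraph_def)
  moreover have "card {u, v} \<le> card (e \<inter> f)"
    using assms finite_edge by (intro card_mono) auto
  ultimately show False using assms by simp
qed

lemma card_Int_edges:
  assumes "e \<in> E" "f \<in> E" "e \<noteq> f" "e \<inter> f \<noteq> {}"
  shows "card (e \<inter> f) = 1"
proof -
  obtain u where u: "u \<in> e \<inter> f" using assms by blast
  then have "e \<inter> f = {u}"
    using edge_eqI assms by blast
  then show ?thesis by simp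
qed

lemma card_star_le:
  assumes "finite b" "v \<notin> b" "F \<subseteq> E" "\<And>f. f \<in> F \<Longrightarrow> v \<in> f \<and> f \<inter> b \<noteq> {}"
  shows "card F \<le> card b"
proof -
  have "\<forall>f\<in>F. \<exists>w. w \<in> f \<inter> b" using assms by blast
  then obtain \<phi> where \<phi>: "\<And>f. f \<in> F \<Longrightarrow> \<phi> f \<in> f \<inter> b" by metis
  have "inj_on \<phi> F"
  proof (rule inj_onI)
    fix f g assume "f \<in> F" "g \<in> F" "\<phi> f = \<phi> g"
    moreover from this have "\<phi> f \<noteq> v" using \<phi> assms by blast
    ultimately show "f = g"
      using edge_eqI[of f g v "\<phi> f"] \<phi> assms by (metis IntD1 subsetD)
  qed
  moreover have "\<phi> ` F \<subseteq> b" using \<phi> by blast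
  ultimately show ?thesis using assms(1) card_inj_on_le by blast
qed

lemma deg_le:
  assumes "F \<subseteq> E" "b \<in> E" "v \<notin> b" "\<And>f. f \<in> F \<Longrightarrow> v \<in> f \<Longrightarrow> f \<inter> b \<noteq> {}"
  shows "deg F v \<le> s"
proof -
  have "deg F v \<le> card b"
    unfolding deg_def using assms finite_edge by (intro card_star_le[of b v]) auto
  then show ?thesis using card_edge assms by simp
qed

lemma sum_deg_edge:
  assumes "e \<in> E" "F \<subseteq> E - {e}" "\<And>f. f \<in> F \<Longrightarrow> f \<inter> e \<noteq> {}"
  shows "(\<Sum>v\<in>e. deg F v) = card F"
proof -
  have "(\<Sum>v\<in>e. deg F v) = (\<Sum>f\<in>F. card (f \<inter> e))"
    using assms finite_edge finite_E by (intro sum_deg) (auto intro: finite_subset)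
  also have "\<dots> = (\<Sum>f\<in>F. 1)"
    using assms by (intro sum.cong refl card_Int_edges) auto
  finally show ?thesis by simp
qed

lemma sum_deg_Union: "(\<Sum>v\<in>\<Union>E. deg E v) = s * card E"
proof -
  have "(\<Sum>v\<in>\<Union>E. deg E v) = (\<Sum>f\<in>E. card (f \<inter> \<Union>E))"
    using finite_Union finite_E by (intro sum_deg) auto
  also have "\<dots> = (\<Sum>f\<in>E. s)"
    using card_edge by (intro sum.cong refl) (metis Sup_upper inf.absorb1)
  finally show ?thesis by (simp add: mult.commute)
qed

lemma intersecting_less:
  assumes "E \<noteq> {}" and int: "\<And>e f. e \<in> E \<Longrightarrow> f \<in> E \<Longrightarrow> e \<inter> f \<noteq> {}"
  shows "s * card E < (s + 1) * card (\<Union>E)"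
proof -
  have fin: "finite (\<Union>E)" using finite_Union by blast
  have "\<Union>E \<noteq> {}" using assms edge_nonempty by blast
  then have pos: "card (\<Union>E) > 0" using fin by (simp add: card_gt_0_iff)
  show ?thesis
  proof (cases "\<forall>v\<in>\<Union>E. deg E v \<le> s")
    case True
    then have "(\<Sum>v\<in>\<Union>E. deg E v) \<le> (\<Sum>v\<in>\<Union>E. s)" by (intro sum_mono) auto
    then have "s * card E \<le> s * card (\<Union>E)" using sum_deg_Union by (simp add: mult.commute)
    moreover have "(s + 1) * card (\<Union>E) = s * card (\<Union>E) + card (\<Union>E)" by simp
    ultimately show ?thesis using pos by linarith
  next
    case False
    then obtain v where v: "v \<in> \<Union>E" "\<not> deg E v \<le> s" by blast
    have star: "v \<in> g" if "g \<in> E" for g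
      using deg_le[of E g v] that v int by blast
    let ?W = "\<Union>E - {v}"
    have "(\<Sum>u\<in>?W. deg E u) = (\<Sum>f\<in>E. card (f \<inter> ?W))"
      using fin finite_E by (intro sum_deg) auto
    also have "\<dots> = (\<Sum>f\<in>E. s - 1)"
    proof (intro sum.cong refl)
      fix f assume f: "f \<in> E"
      then have "f \<inter> ?W = f - {v}" by blast
      then show "card (f \<inter> ?W) = s - 1" using f star card_edge finite_edge by simp
    qed
    finally have 1: "(\<Sum>u\<in>?W. deg E u) = card E * (s - 1)" by simp
    have "(\<Sum>u\<in>?W. deg E u) \<le> (\<Sum>u\<in>?W. 1)"
    proof (intro sum_mono)
      fix u assume u: "u \<in> ?W"
      show "deg E u \<le> 1"
        unfolding deg_def
      proof (rule ccontr)
        assume "\<not> card {f \<in> E. u \<in> f} \<le> 1"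
        then obtain f g where "f \<in> E" "g \<in> E" "u \<in> f" "u \<in> g" "f \<noteq> g"
          using card_le_Suc0_iff_eq[of "{f \<in> E. u \<in> f}"] finite_E by auto
        then show False using edge_eqI[of f g u v] star u by blast
      qed
    qed
    then have "card E * (s - 1) \<le> card (\<Union>E) - 1" using 1 v fin by simp
    moreover have "card E \<le> card E * (s - 1)"
    proof -
      have "1 \<le> s - 1" using s2 by arith
      then have "card E * 1 \<le> card E * (s - 1)" by (rule mult_le_mono2)
      then show ?thesis by simp
    qed
    moreover have "s * card E = card E + card E * (s - 1)"
      using s2 by (cases s) (auto simp: algebra_simps)
    moreover have "2 * card (\<Union>E) \<le> (s + 1) * card (\<Union>E)" using s2 by (intro mult_right_mono) auto
    ultimately show ?thesis using pos by linarith
  qed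
qed

lemma matching_transversal_card:
  assumes "B \<subseteq> E" "g \<in> E - B" "pairwise disjnt B" "\<And>b. b \<in> B \<Longrightarrow> g \<inter> b \<noteq> {}"
  shows "card (g \<inter> \<Union>B) = card B"
proof -
  have "g \<inter> \<Union>B = (\<Union>b\<in>B. g \<inter> b)" by blast
  then have "card (g \<inter> \<Union>B) = card (\<Union>b\<in>B. g \<inter> b)" by (rule arg_cong)
  also have "\<dots> = (\<Sum>b\<in>B. card (g \<inter> b))"
    using assms finite_E finite_edge
    by (intro card_UN_disjoint) (auto intro: finite_subset simp: pairwise_def disjnt_def)
  also have "\<dots> = (\<Sum>b\<in>B. 1)"
    using assms by (intro sum.cong refl card_Int_edges) auto
  finally show ?thesis by simp
qed

lemma card_Union_matching:
  assumes "B \<subseteq> E" "pairwise disjnt B"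
  shows "card (\<Union>B) = s * card B"
proof -
  have "card (\<Union>B) = (\<Sum>b\<in>B. card b)"
    using assms finite_edge by (intro card_Union_disjoint) auto
  also have "\<dots> = (\<Sum>b\<in>B. s)" using assms card_edge by (intro sum.cong) auto
  finally show ?thesis by simp
qed

lemma card_pairs:
  "card (\<Union>e\<in>E. {(x, y). x \<in> e \<and> y \<in> e \<and> x \<noteq> y}) = card E * (s * (s - 1))"
proof -
  have eq: "{(x, y). x \<in> e \<and> y \<in> e \<and> x \<noteq> y} = e \<times> e - Id_on e" for e :: "'a set"
    by auto
  have "card (\<Union>e\<in>E. e \<times> e - Id_on e) = (\<Sum>e\<in>E. card (e \<times> e - Id_on e))"
  proof (intro card_UN_disjoint ballI impI)
    fix e f assume "e \<in> E" "f \<in> E" "e \<noteq> f"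
    then show "(e \<times> e - Id_on e) \<inter> (f \<times> f - Id_on f) = {}"
      using edge_eqI[of e f] by blast
  qed (use finite_E finite_edge in auto)
  also have "\<dots> = (\<Sum>e\<in>E. s * (s - 1))"
    using card_offdiag finite_edge card_edge by (intro sum.cong) auto
  finally show ?thesis unfolding eq by simp
qed

text \<open>Counting ordered pairs: \<open>s(s + 1)\<close> edges of size \<open>s\<close> cover all \<open>s\<^sup>2(s\<^sup>2 - 1)\<close> of them.\<close>

lemma steiner_system_if_card:
  assumes N: "card (\<Union>E) = s * s" and eq: "s * card E = (s + 1) * card (\<Union>E)"
  shows "steiner_system_2 s (s\<^sup>2) (\<Union>E) E"
proof -
  let ?A = "\<Union>e\<in>E. {(x, y). x \<in> e \<and> y \<in> e \<and> x \<noteq> y}"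
  let ?B = "\<Union>E \<times> \<Union>E - Id_on (\<Union>E)"
  have fin: "finite (\<Union>E)" using finite_Union by blast
  have "s * card E = s * ((s + 1) * s)" using eq N by (simp add: algebra_simps)
  then have E: "card E = (s + 1) * s" using s2 unfolding mult_cancel1 by simp
  have "?A = ?B"
  proof (rule card_subset_eq)
    show "finite ?B" using fin by simp
    show "?A \<subseteq> ?B" by auto
    have "card ?A = (s + 1) * s * (s * (s - 1))" using card_pairs E by simp
    also have "\<dots> = (s * s) * (s * s - 1)"
      by (cases s) (auto simp: algebra_simps)
    also have "\<dots> = card ?B" using card_offdiag[OF fin] N by simp
    finally show "card ?A = card ?B" .
  qed
  then have "\<exists>!b. b \<in> E \<and> x \<in> b \<and> y \<in> b" if "x \<in> \<Union>E" "y \<in> \<Union>E" "x \<noteq> y" for x y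
  proof -
    have "(x, y) \<in> ?A" unfolding \<open>?A = ?B\<close> using that by auto
    then show ?thesis using edge_eqI that by blast
  qed
  then show ?thesis
    unfolding steiner_system_2_def hypergraph_def
    using fin N unif by (auto simp: power2_eq_square)
qed

lemma card_if_steiner_system:
  assumes st: "steiner_system_2 s (s\<^sup>2) C E"
  shows "s * card E = (s + 1) * card C"
proof -
  have C: "finite C" "card C = s * s" using st by (auto simp: steiner_system_2_def power2_eq_square)
  have sub: "\<And>e. e \<in> E \<Longrightarrow> e \<subseteq> C"
    and ex: "\<And>x y. x \<in> C \<Longrightarrow> y \<in> C \<Longrightarrow> x \<noteq> y \<Longrightarrow> \<exists>b\<in>E. x \<in> b \<and> y \<in> b"
    using st unfolding steiner_system_2_def hypergraph_def by blast+
  have "(\<Union>e\<in>E. {(x, y). x \<in> e \<and> y \<in> e \<and> x \<noteq> y}) = C \<times> C - Id_on C"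
  proof (intro equalityI subsetI)
    fix z assume "z \<in> C \<times> C - Id_on C"
    then show "z \<in> (\<Union>e\<in>E. {(x, y). x \<in> e \<and> y \<in> e \<and> x \<noteq> y})"
      using ex by (cases z) auto
  qed (use sub in auto)
  then have "card E * (s * (s - 1)) = card (C \<times> C - Id_on C)" using card_pairs by simp
  also have "\<dots> = (s * s) * (s * s - 1)" using card_offdiag[OF C(1)] C(2) by simp
  also have "\<dots> = (s + 1) * s * (s * (s - 1))"
    by (cases s) (auto simp: algebra_simps)
  finally have "card E = (s + 1) * s" using s2 by simp
  then show ?thesis using C by (simp add: algebra_simps)
qed

end

locale linear_P4_free = linear_uniform +
  assumes P4: "P4_free s E"
begin

lemma no_induced_P4:
  assumes "a \<in> E" "b \<in> E" "c \<in> E" "d \<in> E"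
    and "a \<inter> b \<noteq> {}" "b \<inter> c \<noteq> {}" "c \<inter> d \<noteq> {}"
    and "a \<inter> c = {}" "a \<inter> d = {}" "b \<inter> d = {}"
  shows False
proof -
  have neq: "x \<noteq> y" if "x \<inter> z = {}" "y \<inter> z \<noteq> {}" for x y z :: "'a set"
    using that by auto
  have ne: "a \<noteq> b" "a \<noteq> c" "a \<noteq> d" "b \<noteq> c" "d \<noteq> b" "d \<noteq> c"
    using neq[of a c b] neq[of a d c] neq[of a c d] neq[of b d c] neq[of d a b] neq[of d b c]
      assms(5-10) by (simp_all add: Int_commute)
  have "card (a \<inter> b) = 1" "card (b \<inter> c) = 1" "card (c \<inter> d) = 1"
    using card_Int_edges[OF assms(1,2) ne(1) assms(5)] card_Int_edges[OF assms(2,3) ne(4) assms(6)]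
      card_Int_edges[OF assms(3,4) ne(6)[symmetric] assms(7)] by simp_all
  moreover have "uniform s {a, b, c, d}" using unif assms(1-4) by (simp add: uniform_def)
  moreover have "distinct [a, b, c, d]" using ne by simp
  ultimately have "is_P4 s {a, b, c, d}"
    unfolding is_P4_def using assms(8-10)
    by (intro conjI exI[of _ a] exI[of _ b] exI[of _ c] exI[of _ d]) simp_all
  moreover have "{a, b, c, d} \<subseteq> E" using assms(1-4) by simp
  ultimately show False using P4 unfolding P4_free_def by blast
qed

text \<open>\<open>P \<union> Q\<close> is chosen as a maximal disconnected subset of \<open>D\<close>.\<close>

lemma cograph_split:
  assumes D: "D \<subseteq> E" and conn: "\<not> disconnected D"
    and e: "e1 \<in> D" "e2 \<in> D" "e1 \<inter> e2 = {}"
  obtains P Q S where "D = P \<union> Q \<union> S" "P \<noteq> {}" "Q \<noteq> {}" "S \<noteq> {}" "S \<inter> (P \<union> Q) = {}"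
    "\<And>p q. p \<in> P \<Longrightarrow> q \<in> Q \<Longrightarrow> p \<inter> q = {}"
    "\<And>g b. g \<in> S \<Longrightarrow> b \<in> P \<union> Q \<Longrightarrow> g \<inter> b \<noteq> {}"
proof -
  have "finite D" using D finite_E finite_subset by blast
  have "disconnected {e1, e2}"
    by (rule disconnectedI[of "{e1}" "{e2}"]) (use e in auto)
  then have "{e1, e2} \<in> {B. B \<subseteq> D \<and> disconnected B}" using e by simp
  moreover have "finite {B. B \<subseteq> D \<and> disconnected B}" using \<open>finite D\<close> by simp
  ultimately have "\<exists>B\<in>{B. B \<subseteq> D \<and> disconnected B}. {e1, e2} \<subseteq> B \<and>
    (\<forall>C\<in>{B. B \<subseteq> D \<and> disconnected B}. B \<subseteq> C \<longrightarrow> B = C)"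
    by (intro finite_has_maximal2)
  then obtain B where BM: "B \<in> {B. B \<subseteq> D \<and> disconnected B}"
    and max': "\<forall>C\<in>{B. B \<subseteq> D \<and> disconnected B}. B \<subseteq> C \<longrightarrow> B = C"
    by (elim bexE conjE) (rule that)
  from BM have B: "B \<subseteq> D" "disconnected B" by simp_all
  have max: "B = C" if "C \<subseteq> D" "disconnected C" "B \<subseteq> C" for C
    using max' that by simp
  obtain P Q where PQ: "P \<noteq> {}" "Q \<noteq> {}" "B = P \<union> Q"
    "\<And>p q. p \<in> P \<Longrightarrow> q \<in> Q \<Longrightarrow> p \<inter> q = {}"
    by (rule disconnectedE[OF B(2)], rule that)
  have key: "g \<inter> b \<noteq> {}"
    if g: "g \<in> D - B" and b: "b \<in> P'" and PQ': "P' \<noteq> {}" "Q' \<noteq> {}" "B = P' \<union> Q'"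
      "\<And>p q. p \<in> P' \<Longrightarrow> q \<in> Q' \<Longrightarrow> p \<inter> q = {}" for g b P' Q'
  proof
    assume gb: "g \<inter> b = {}"
    have nd: "\<not> disconnected (insert g B)"
    proof
      assume "disconnected (insert g B)"
      then have "B = insert g B" using g B(1) by (intro max) auto
      then show False using g by blast
    qed
    have "\<exists>q\<in>Q'. q \<inter> g \<noteq> {}"
    proof (rule ccontr)
      assume "\<not> ?thesis"
      then have gy: "g \<inter> y = {}" if "y \<in> Q'" for y using that by blast
      have "x \<inter> y = {}" if "x \<in> insert g P'" "y \<in> Q'" for x y
        using that PQ'(4)[of x y] gy[of y] by (cases "x = g") auto
      then have "disconnected (insert g B)"
        using PQ'(1-3) by (intro disconnectedI[of "insert g P'" Q']) auto
      then show False using nd by blast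
    qed
    then obtain q where q: "q \<in> Q'" "q \<inter> g \<noteq> {}" by blast
    define M where "M = {p \<in> P'. g \<inter> p = {}}"
    have "\<exists>m\<in>M. \<exists>a\<in>P' - M. a \<inter> m \<noteq> {}"
    proof (rule ccontr)
      assume "\<not> ?thesis"
      then have none: "\<forall>m\<in>M. \<forall>a\<in>P' - M. a \<inter> m = {}" by simp
      have "disconnected (insert g B)"
      proof (rule disconnectedI[of M "insert g ((P' - M) \<union> Q')"])
        have "b \<in> M" using b gb by (simp add: M_def)
        then show "M \<noteq> {}" by blast
        show "insert g B = M \<union> insert g (P' - M \<union> Q')"
          unfolding PQ'(3) M_def by blast
        fix m x assume "m \<in> M" "x \<in> insert g (P' - M \<union> Q')"
        then consider "x = g" | "x \<in> P' - M" | "x \<in> Q'" by blast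
        then show "m \<inter> x = {}"
        proof cases
          case 1
          then show ?thesis using \<open>m \<in> M\<close> by (simp add: M_def Int_commute)
        next
          case 2
          then have "x \<inter> m = {}" using \<open>m \<in> M\<close> none by simp
          then show ?thesis by (simp only: Int_commute)
        next
          case 3
          then show ?thesis using \<open>m \<in> M\<close> PQ'(4) by (simp add: M_def)
        qed
      qed simp
      then show False using nd by blast
    qed
    then obtain m a where "m \<in> M" "a \<in> P' - M" and am: "a \<inter> m \<noteq> {}" by blast
    then have ma: "m \<in> P'" "g \<inter> m = {}" "a \<in> P'" "g \<inter> a \<noteq> {}" by (simp_all add: M_def)
    have "q \<inter> a = {}" "q \<inter> m = {}"
      using PQ'(4)[OF ma(3) q(1)] PQ'(4)[OF ma(1) q(1)] by (simp_all add: Int_commute)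
    moreover have "B \<subseteq> E" using B(1) D by (rule order_trans)
    then have "q \<in> E" "a \<in> E" "m \<in> E" using PQ'(3) q(1) ma(1,3) by auto
    moreover have "g \<in> E" using g D by blast
    ultimately show False using no_induced_P4[of q g a m] q(2) ma(2,4) am by simp
  qed
  show thesis
  proof (rule that[of P Q "D - B"])
    show "D = P \<union> Q \<union> (D - B)" "(D - B) \<inter> (P \<union> Q) = {}"
      unfolding PQ(3)[symmetric] using B(1) by auto
    show "p \<inter> q = {}" if "p \<in> P" "q \<in> Q" for p q using that by (rule PQ(4))
    show "D - B \<noteq> {}"
    proof
      assume "D - B = {}"
      then have "D = B" using B(1) by blast
      then show False using B(2) conn by simp
    qed
    show "g \<inter> b \<noteq> {}" if "g \<in> D - B" "b \<in> P \<union> Q" for g b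
    proof (cases "b \<in> P")
      case True
      show ?thesis by (rule key[OF that(1) True PQ])
    next
      case False
      then have b: "b \<in> Q" using that by blast
      have B': "B = Q \<union> P" using PQ(3) by (simp only: Un_commute)
      have QP: "p \<inter> q = {}" if "p \<in> Q" "q \<in> P" for p q
        using PQ(4)[OF that(2,1)] by (simp only: Int_commute)
      show ?thesis by (rule key[OF that(1) b PQ(2,1) B' QP])
    qed
  qed (rule PQ)+
qed

lemma intersecting_module_bound:
  assumes D: "D \<subseteq> E" "D \<noteq> {}" and N: "N \<subseteq> E" "N \<noteq> {}" "N \<inter> D = {}"
    and OD: "\<And>g e. g \<in> N \<Longrightarrow> e \<in> D \<Longrightarrow> g \<inter> e \<noteq> {}"
    and clo: "\<And>g. g \<in> E \<Longrightarrow> g \<inter> \<Union>D \<noteq> {} \<Longrightarrow> g \<in> D \<union> N"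
    and e': "e' \<in> E" "e' \<inter> \<Union>D = {}" "\<And>g. g \<in> N \<Longrightarrow> g \<inter> e' \<noteq> {}"
    and int: "\<And>e f. e \<in> D \<Longrightarrow> f \<in> D \<Longrightarrow> e \<inter> f \<noteq> {}"
  shows "(\<Sum>v\<in>\<Union>D. deg E v) \<le> (s + 1) * card (\<Union>D) \<and>
    ((\<Sum>v\<in>\<Union>D. deg E v) = (s + 1) * card (\<Union>D) \<longrightarrow> card D = 1)"
proof -
  obtain e where e: "e \<in> D" using D by blast
  then have eE: "e \<in> E" using D by blast
  have finD: "finite D" and finO: "finite N"
    using D N finite_E finite_subset by blast+
  have finV: "finite (\<Union>D)" using finite_Union D by blast
  define W where "W = \<Union>D - e"
  have finW: "finite W" using finV W_def by simp
  have VW: "\<Union>D = e \<union> W" "e \<inter> W = {}" using e W_def by auto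
  have cardV: "card (\<Union>D) = s + card W"
    using VW finW finite_edge[OF eE] card_edge[OF eE] by (simp add: card_Un_disjoint)
  have degW: "deg E v \<le> s" if "v \<in> W" for v
  proof (rule deg_le[of E e])
    show "v \<notin> e" using that W_def by blast
    fix f assume f: "f \<in> E" "v \<in> f"
    then have "f \<in> D \<union> N" using that W_def by (intro clo) auto
    then show "f \<inter> e \<noteq> {}" using OD int e by blast
  qed (use eE in auto)
  have degDW: "deg D v \<le> s - 1" if v: "v \<in> W" for v
  proof -
    obtain g where g: "g \<in> N" using N by blast
    then have gE: "g \<in> E" using N by blast
    show ?thesis
    proof (cases "v \<in> g")
      case True
      have "card (insert g {f \<in> D. v \<in> f}) \<le> card e"
      proof (rule card_star_le[of e v])
        fix f assume "f \<in> insert g {f \<in> D. v \<in> f}"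
        then show "v \<in> f \<and> f \<inter> e \<noteq> {}" using True OD[OF g e] int[OF _ e, of f] by blast
      qed (use v gE D(1) finite_edge[OF eE] W_def in auto)
      moreover have "g \<notin> D" using g N by blast
      ultimately show ?thesis
        using card_edge[OF eE] finD by (simp add: deg_def)
    next
      case False
      have ge': "g \<inter> e' \<noteq> {}" using e' g by blast
      have "deg D v \<le> card (g - e')"
        unfolding deg_def
      proof (intro card_star_le[of _ v])
        fix f assume "f \<in> {f \<in> D. v \<in> f}"
        then show "v \<in> f \<and> f \<inter> (g - e') \<noteq> {}"
          using OD[OF g, of f] e'(2) by blast
      qed (use False D(1) finite_edge[OF gE] in auto)
      moreover have "card (g - e') = s - 1"
      proof -
        have "g \<noteq> e'" using g e' OD e by blast
        then have "card (g \<inter> e') = 1" using card_Int_edges gE e' ge' by blast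
        then show ?thesis
          using card_Diff_subset_Int[of g e'] finite_edge[OF gE] card_edge[OF gE] by simp
      qed
      ultimately show ?thesis by simp
    qed
  qed
  have cardD: "card D - 1 \<le> card W"
  proof -
    have "(\<Sum>v\<in>W. deg (D - {e}) v) = (\<Sum>f\<in>D - {e}. card (f \<inter> W))"
      using finW finD by (intro sum_deg) auto
    also have "\<dots> = (\<Sum>f\<in>D - {e}. s - 1)"
    proof (intro sum.cong refl)
      fix f assume f: "f \<in> D - {e}"
      then have "card (f \<inter> e) = 1"
        using int[of f e] e D(1) by (intro card_Int_edges) auto
      moreover have "f \<inter> W = f - e" using f W_def by blast
      ultimately show "card (f \<inter> W) = s - 1"
        using card_Diff_subset_Int[of f e] finite_edge card_edge f D by fastforce
    qed
    also have "\<dots> = (card D - 1) * (s - 1)" using e finD by simp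
    finally have "(card D - 1) * (s - 1) \<le> (\<Sum>v\<in>W. s - 1)"
      using degDW deg_mono[OF finD, of "D - {e}"] by (metis (no_types, lifting) Diff_subset le_trans sum_mono)
    then show ?thesis using s2 by simp
  qed
  have sume: "(\<Sum>v\<in>e. deg E v) = s + (card D - 1) + card N"
  proof -
    have "deg E v = 1 + deg ((D - {e}) \<union> N) v" if v: "v \<in> e" for v
    proof -
      have "{f \<in> E. v \<in> f} = insert e {f \<in> (D - {e}) \<union> N. v \<in> f}"
        using v e eE D(1) N(1) clo by blast
      moreover have "e \<notin> {f \<in> (D - {e}) \<union> N. v \<in> f}" using N e by blast
      ultimately show ?thesis using finD finO by (simp add: deg_def)
    qed
    then have "(\<Sum>v\<in>e. deg E v) = s + (\<Sum>v\<in>e. deg ((D - {e}) \<union> N) v)"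
      using card_edge[OF eE] by (simp add: sum_Suc)
    also have "(\<Sum>v\<in>e. deg ((D - {e}) \<union> N) v) = card ((D - {e}) \<union> N)"
    proof (rule sum_deg_edge)
      show "D - {e} \<union> N \<subseteq> E - {e}" using D(1) N e by blast
      show "f \<inter> e \<noteq> {}" if "f \<in> D - {e} \<union> N" for f using that int OD e by blast
    qed (rule eE)
    also have "\<dots> = (card D - 1) + card N"
      using finD finO N e by (subst card_Un_disjoint) auto
    finally show ?thesis by simp
  qed
  have sumO: "card N = (\<Sum>v\<in>e. deg N v)"
  proof (rule sum_deg_edge[symmetric])
    show "N \<subseteq> E - {e}" using N e by blast
  qed (use eE OD e in auto)
  have degO: "deg N v \<le> s" if "v \<in> e" for v
  proof (rule deg_le[of N e'])
    show "v \<notin> e'" using that e'(2) e by blast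
  qed (use N e' in auto)
  have cardO: "card N \<le> s * s"
    using sum_bounded_above[of e "deg N" s] degO sumO card_edge[OF eE] by simp
  have total: "(\<Sum>v\<in>\<Union>D. deg E v) \<le> s + (card D - 1) + card N + s * card W"
  proof -
    have "(\<Sum>v\<in>\<Union>D. deg E v) = (\<Sum>v\<in>e. deg E v) + (\<Sum>v\<in>W. deg E v)"
      unfolding VW(1) using VW(2) finW finite_edge[OF eE] by (intro sum.union_disjoint)
    moreover have "(\<Sum>v\<in>W. deg E v) \<le> card W * s"
      using sum_bounded_above[of W "deg E" s] degW by simp
    ultimately show ?thesis using sume by (simp add: mult.commute)
  qed
  have rhs: "(s + 1) * card (\<Union>D) = s + card W + s * s + s * card W"
    using cardV by (simp add: algebra_simps)
  have "card N < s * s" if "card D \<noteq> 1"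
  proof -
    have "D \<noteq> {e}" using that by auto
    then obtain e2 where e2: "e2 \<in> D" "e2 \<noteq> e" using e by blast
    obtain x where x: "x \<in> e" "x \<in> e2" using int e e2 by blast
    have "e \<noteq> {x}" using card_edge[OF eE] s2 by auto
    then obtain v where v: "v \<in> e" "v \<noteq> x" using x by blast
    have "v \<notin> e2" using edge_eqI[of e e2 v x] v x e2 D eE by blast
    have fin2: "finite e2" "card e2 = s" using finite_edge card_edge e2 D by auto
    have "deg N v \<le> card (e2 - {x})"
      unfolding deg_def
    proof (intro card_star_le[of _ v])
      fix f assume "f \<in> {f \<in> N. v \<in> f}"
      then have f: "f \<in> N" "v \<in> f" by auto
      then have "x \<notin> f" using edge_eqI[of e f v x] v x eE N e by blast
      then show "v \<in> f \<and> f \<inter> (e2 - {x}) \<noteq> {}" using f OD[of f e2] e2 by blast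
    qed (use \<open>v \<notin> e2\<close> fin2 N in auto)
    then have "deg N v < s" using fin2 x s2 by simp
    then have "(\<Sum>v\<in>e. deg N v) < (\<Sum>v\<in>e. s)"
      using v degO finite_edge[OF eE] by (intro sum_strict_mono_ex1) auto
    then show ?thesis using sumO card_edge[OF eE] by simp
  qed
  then show ?thesis using total rhs cardO cardD by linarith
qed

lemma join_bound:
  assumes D: "D \<subseteq> E" "D = P \<union> Q \<union> S" "P \<noteq> {}" "Q \<noteq> {}" "S \<noteq> {}" "S \<inter> (P \<union> Q) = {}"
    and PQ: "\<And>p q. p \<in> P \<Longrightarrow> q \<in> Q \<Longrightarrow> p \<inter> q = {}"
    and S: "\<And>g b. g \<in> S \<Longrightarrow> b \<in> P \<union> Q \<Longrightarrow> g \<inter> b \<noteq> {}"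
    and OD: "\<And>g e. g \<in> N \<Longrightarrow> e \<in> D \<Longrightarrow> g \<inter> e \<noteq> {}"
    and clo: "\<And>g. g \<in> E \<Longrightarrow> g \<inter> \<Union>D \<noteq> {} \<Longrightarrow> g \<in> D \<union> N"
    and bP: "(\<Sum>v\<in>\<Union>P. deg E v) \<le> (s + 1) * card (\<Union>P) \<and>
      ((\<Sum>v\<in>\<Union>P. deg E v) = (s + 1) * card (\<Union>P) \<longrightarrow> pairwise disjnt P)"
    and bQ: "(\<Sum>v\<in>\<Union>Q. deg E v) \<le> (s + 1) * card (\<Union>Q) \<and>
      ((\<Sum>v\<in>\<Union>Q. deg E v) = (s + 1) * card (\<Union>Q) \<longrightarrow> pairwise disjnt Q)"
  shows "(\<Sum>v\<in>\<Union>D. deg E v) \<le> (s + 1) * card (\<Union>D) \<and>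
    ((\<Sum>v\<in>\<Union>D. deg E v) = (s + 1) * card (\<Union>D) \<longrightarrow>
      pairwise disjnt (P \<union> Q) \<and> \<Union>(P \<union> Q) = \<Union>D \<and> card (P \<union> Q) = s)"
proof -
  have finV: "finite (\<Union>D)" using finite_Union D by blast
  define W where "W = \<Union>D - \<Union>(P \<union> Q)"
  have U: "\<Union>D = (\<Union>P \<union> \<Union>Q) \<union> W" using D W_def by auto
  have disj: "\<Union>P \<inter> \<Union>Q = {}" "(\<Union>P \<union> \<Union>Q) \<inter> W = {}" using PQ W_def by auto
  have fin: "finite (\<Union>P)" "finite (\<Union>Q)" "finite W" using finV U by auto
  have sum: "(\<Sum>v\<in>\<Union>D. deg E v) = (\<Sum>v\<in>\<Union>P. deg E v) + (\<Sum>v\<in>\<Union>Q. deg E v) + (\<Sum>v\<in>W. deg E v)"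
    unfolding U using fin disj by (simp add: sum.union_disjoint)
  have card: "(s + 1) * card (\<Union>D) = (s + 1) * card (\<Union>P) + (s + 1) * card (\<Union>Q) + (s + 1) * card W"
    unfolding U using fin disj by (simp add: card_Un_disjoint algebra_simps)
  obtain b where b: "b \<in> P" using D by blast
  have degW: "deg E v \<le> s" if v: "v \<in> W" for v
  proof (rule deg_le[of E b])
    show "b \<in> E" using b D by blast
    show "v \<notin> b" using v b W_def by blast
    fix f assume f: "f \<in> E" "v \<in> f"
    then have "f \<in> D \<union> N" using clo[of f] v W_def by blast
    moreover have "f \<notin> P \<union> Q" using f v W_def by blast
    ultimately show "f \<inter> b \<noteq> {}" using S[of f b] OD[of f b] b D by blast
  qed simp
  have sumW: "(\<Sum>v\<in>W. deg E v) \<le> s * card W"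
    using sum_bounded_above[of W "deg E" s] degW by (simp add: mult.commute)
  have "(s + 1) * card W = s * card W + card W" by simp
  then have le: "(\<Sum>v\<in>\<Union>D. deg E v) \<le> (s + 1) * card (\<Union>D)"
    using sum card sumW bP bQ by linarith
  moreover have "pairwise disjnt (P \<union> Q) \<and> \<Union>(P \<union> Q) = \<Union>D \<and> card (P \<union> Q) = s"
    if eq: "(\<Sum>v\<in>\<Union>D. deg E v) = (s + 1) * card (\<Union>D)"
  proof -
    have "card W = 0" "(\<Sum>v\<in>\<Union>P. deg E v) = (s + 1) * card (\<Union>P)"
      "(\<Sum>v\<in>\<Union>Q. deg E v) = (s + 1) * card (\<Union>Q)"
      using eq sum card sumW bP bQ \<open>(s + 1) * card W = s * card W + card W\<close> by linarith+
    then have "W = {}" "pairwise disjnt P" "pairwise disjnt Q" using fin bP bQ by auto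
    then have m: "pairwise disjnt (P \<union> Q)"
      using PQ unfolding pairwise_def disjnt_def by blast
    moreover have V: "\<Union>(P \<union> Q) = \<Union>D" using U \<open>W = {}\<close> by auto
    moreover have "card (P \<union> Q) = s"
    proof -
      obtain g where g: "g \<in> S" using D by blast
      then have "card (g \<inter> \<Union>(P \<union> Q)) = card (P \<union> Q)"
        using D m S by (intro matching_transversal_card) auto
      moreover have "g \<inter> \<Union>(P \<union> Q) = g" using V D g by blast
      ultimately show ?thesis using card_edge[of g] g D by auto
    qed
    ultimately show ?thesis by blast
  qed
  ultimately show ?thesis by blast
qed

text \<open>In the line graph, \<open>D\<close> is a module with outer neighbourhood \<open>N\<close>, and \<open>e'\<close> is a non-neighbour
  dominating \<open>N\<close>. Each part of a split inherits such an \<open>e'\<close> from the other part.\<close>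

lemma module_bound:
  assumes "D \<subseteq> E" "D \<noteq> {}" "N \<subseteq> E" "N \<noteq> {}" "N \<inter> D = {}"
    and "\<And>g e. g \<in> N \<Longrightarrow> e \<in> D \<Longrightarrow> g \<inter> e \<noteq> {}"
    and "\<And>g. g \<in> E \<Longrightarrow> g \<inter> \<Union>D \<noteq> {} \<Longrightarrow> g \<in> D \<union> N"
    and "e' \<in> E" "e' \<inter> \<Union>D = {}" "\<And>g. g \<in> N \<Longrightarrow> g \<inter> e' \<noteq> {}"
  shows "(\<Sum>v\<in>\<Union>D. deg E v) \<le> (s + 1) * card (\<Union>D) \<and>
    ((\<Sum>v\<in>\<Union>D. deg E v) = (s + 1) * card (\<Union>D) \<longrightarrow> pairwise disjnt D)"
  using assms
proof (induction "card D" arbitrary: D N e' rule: less_induct)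
  case less
  note D = less.prems(1,2) and N = less.prems(3-5) and OD = less.prems(6)
    and clo = less.prems(7) and e' = less.prems(8-10)
  have finD: "finite D" using D finite_E finite_subset by blast
  have finV: "finite (\<Union>D)" using finite_Union D by blast
  consider "disconnected D" | "\<forall>e\<in>D. \<forall>f\<in>D. e \<inter> f \<noteq> {}"
    | e1 e2 where "\<not> disconnected D" "e1 \<in> D" "e2 \<in> D" "e1 \<inter> e2 = {}"
    by blast
  then show ?case
  proof cases
    case 1
    obtain P Q where PQ: "P \<noteq> {}" "Q \<noteq> {}" "D = P \<union> Q"
      "\<And>p q. p \<in> P \<Longrightarrow> q \<in> Q \<Longrightarrow> p \<inter> q = {}"
      by (rule disconnectedE[OF 1], rule that)
    have UPQ: "\<Union>P \<inter> \<Union>Q = {}" using PQ(4) by blast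
    have disj: "P \<inter> Q = {}"
    proof (rule ccontr)
      assume "P \<inter> Q \<noteq> {}"
      then obtain p where p: "p \<in> P" "p \<in> Q" by blast
      then have "p \<noteq> {}" using PQ(3) D(1) edge_nonempty by blast
      then show False using PQ(4)[OF p] by simp
    qed
    have "P \<subset> D" "Q \<subset> D" using PQ(1-3) disj by auto
    then have "card P < card D" "card Q < card D"
      using finD by (simp_all add: psubset_card_mono)
    have bP: "(\<Sum>v\<in>\<Union>P. deg E v) \<le> (s + 1) * card (\<Union>P) \<and>
      ((\<Sum>v\<in>\<Union>P. deg E v) = (s + 1) * card (\<Union>P) \<longrightarrow> pairwise disjnt P)"
    proof (rule less.hyps[of P N e'])
      show "g \<in> P \<union> N" if "g \<in> E" "g \<inter> \<Union>P \<noteq> {}" for g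
      proof -
        have "g \<in> D \<union> N" using clo[of g] that PQ(3) by blast
        moreover have "g \<notin> Q" using that UPQ by blast
        ultimately show ?thesis using PQ(3) by blast
      qed
    qed (use \<open>card P < card D\<close> D(1) N OD e' PQ(1-3) disj in auto)
    have bQ: "(\<Sum>v\<in>\<Union>Q. deg E v) \<le> (s + 1) * card (\<Union>Q) \<and>
      ((\<Sum>v\<in>\<Union>Q. deg E v) = (s + 1) * card (\<Union>Q) \<longrightarrow> pairwise disjnt Q)"
    proof (rule less.hyps[of Q N e'])
      show "g \<in> Q \<union> N" if "g \<in> E" "g \<inter> \<Union>Q \<noteq> {}" for g
      proof -
        have "g \<in> D \<union> N" using clo[of g] that PQ(3) by blast
        moreover have "g \<notin> P" using that UPQ by blast
        ultimately show ?thesis using PQ(3) by blast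
      qed
    qed (use \<open>card Q < card D\<close> D(1) N OD e' PQ(1-3) disj in auto)
    have U: "\<Union>D = \<Union>P \<union> \<Union>Q" using PQ by blast
    have fin: "finite (\<Union>P)" "finite (\<Union>Q)" using finV U by auto
    have "(\<Sum>v\<in>\<Union>D. deg E v) = (\<Sum>v\<in>\<Union>P. deg E v) + (\<Sum>v\<in>\<Union>Q. deg E v)"
      unfolding U using fin UPQ by (intro sum.union_disjoint)
    moreover have "(s + 1) * card (\<Union>D) = (s + 1) * card (\<Union>P) + (s + 1) * card (\<Union>Q)"
      unfolding U using fin UPQ by (subst card_Un_disjoint) (auto simp: algebra_simps)
    moreover have "pairwise disjnt D" if "pairwise disjnt P" "pairwise disjnt Q"
      using that PQ unfolding pairwise_def disjnt_def by blast
    ultimately show ?thesis using bP bQ by linarith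
  next
    case 2
    then have "(\<Sum>v\<in>\<Union>D. deg E v) \<le> (s + 1) * card (\<Union>D) \<and>
      ((\<Sum>v\<in>\<Union>D. deg E v) = (s + 1) * card (\<Union>D) \<longrightarrow> card D = 1)"
      using D N OD clo e' by (intro intersecting_module_bound[of D N e']) auto
    moreover have "pairwise disjnt D" if "card D = 1"
      using that by (auto simp: card_1_singleton_iff)
    ultimately show ?thesis by blast
  next
    case 3
    obtain P Q S where PQS: "D = P \<union> Q \<union> S" "P \<noteq> {}" "Q \<noteq> {}" "S \<noteq> {}" "S \<inter> (P \<union> Q) = {}"
      and PQ: "\<And>p q. p \<in> P \<Longrightarrow> q \<in> Q \<Longrightarrow> p \<inter> q = {}"
      and S: "\<And>g b. g \<in> S \<Longrightarrow> b \<in> P \<union> Q \<Longrightarrow> g \<inter> b \<noteq> {}"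
      by (rule cograph_split[OF D(1) 3], rule that)
    have bound: "(\<Sum>v\<in>\<Union>X. deg E v) \<le> (s + 1) * card (\<Union>X) \<and>
      ((\<Sum>v\<in>\<Union>X. deg E v) = (s + 1) * card (\<Union>X) \<longrightarrow> pairwise disjnt X)"
      if X: "X \<noteq> {}" "Y \<noteq> {}" "X \<union> Y = P \<union> Q" "\<And>p q. p \<in> X \<Longrightarrow> q \<in> Y \<Longrightarrow> p \<inter> q = {}" for X Y
    proof -
      have sub: "X \<subseteq> P \<union> Q" using X(3) by blast
      obtain y where y: "y \<in> Y" using X(2) by blast
      have yPQ: "y \<in> P \<union> Q" using X(3) y by blast
      have PQD: "P \<union> Q \<subseteq> D" "S \<subseteq> D" using PQS(1) by auto
      have SX: "S \<inter> X = {}" using PQS(5) sub by blast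
      show ?thesis
      proof (rule less.hyps[of X "N \<union> S" y])
        have "X \<subset> D" using SX PQS(4) PQD sub by blast
        then show "card X < card D" by (rule psubset_card_mono[OF finD])
        show "X \<subseteq> E" using sub PQD(1) D(1) by (meson order_trans)
        show "y \<in> E" using yPQ PQD(1) D(1) by blast
        show "X \<noteq> {}" by fact
        show "N \<union> S \<subseteq> E" "N \<union> S \<noteq> {}" using N PQD D(1) by auto
        show "(N \<union> S) \<inter> X = {}" using SX N(3) sub PQD by blast
        show "g \<in> X \<union> (N \<union> S)" if g: "g \<in> E" "g \<inter> \<Union>X \<noteq> {}" for g
        proof -
          have "\<Union>X \<subseteq> \<Union>D" using sub PQD(1) by (meson Union_mono order_trans)
          then have "g \<in> D \<union> N" using clo[of g] g by blast
          moreover have "g \<notin> Y" using g(2) X(4) by blast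
          ultimately show ?thesis using PQS(1) X(3) by blast
        qed
        show "y \<inter> \<Union>X = {}" using X(4)[OF _ y] by blast
        show "g \<inter> f \<noteq> {}" if "g \<in> N \<union> S" "f \<in> X" for g f
        proof (cases "g \<in> S")
          case True
          then show ?thesis using S that(2) sub by blast
        next
          case False
          then have "g \<in> N" "f \<in> D" using that sub PQD by auto
          then show ?thesis by (rule OD)
        qed
        show "g \<inter> y \<noteq> {}" if "g \<in> N \<union> S" for g
        proof (cases "g \<in> S")
          case True
          then show ?thesis using S yPQ by blast
        next
          case False
          then have "g \<in> N" "y \<in> D" using that yPQ PQD by auto
          then show ?thesis by (rule OD)
        qed
      qed
    qed
    have bP: "(\<Sum>v\<in>\<Union>P. deg E v) \<le> (s + 1) * card (\<Union>P) \<and>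
      ((\<Sum>v\<in>\<Union>P. deg E v) = (s + 1) * card (\<Union>P) \<longrightarrow> pairwise disjnt P)"
      by (rule bound[OF PQS(2,3) refl PQ])
    have QP: "p \<inter> q = {}" if "p \<in> Q" "q \<in> P" for p q
      using PQ[OF that(2,1)] by (simp only: Int_commute)
    have bQ: "(\<Sum>v\<in>\<Union>Q. deg E v) \<le> (s + 1) * card (\<Union>Q) \<and>
      ((\<Sum>v\<in>\<Union>Q. deg E v) = (s + 1) * card (\<Union>Q) \<longrightarrow> pairwise disjnt Q)"
      by (rule bound[OF PQS(3,2) Un_commute QP])
    have join: "(\<Sum>v\<in>\<Union>D. deg E v) \<le> (s + 1) * card (\<Union>D) \<and>
      ((\<Sum>v\<in>\<Union>D. deg E v) = (s + 1) * card (\<Union>D) \<longrightarrow>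
        pairwise disjnt (P \<union> Q) \<and> \<Union>(P \<union> Q) = \<Union>D \<and> card (P \<union> Q) = s)"
      by (rule join_bound[OF D(1) PQS PQ S OD clo bP bQ])
    moreover have False if eq: "(\<Sum>v\<in>\<Union>D. deg E v) = (s + 1) * card (\<Union>D)"
    proof -
      obtain g where g: "g \<in> N" using N by blast
      have gE: "g \<in> E" using g N by blast
      have "card (g \<inter> \<Union>(P \<union> Q)) = card (P \<union> Q)"
      proof (rule matching_transversal_card)
        show "P \<union> Q \<subseteq> E" using D(1) PQS(1) by blast
        show "g \<in> E - (P \<union> Q)" using g gE N(3) PQS(1) by blast
        show "pairwise disjnt (P \<union> Q)" using join eq by blast
        show "g \<inter> b \<noteq> {}" if "b \<in> P \<union> Q" for b
          using that PQS(1) by (intro OD[OF g]) blast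
      qed
      then have "card (g \<inter> \<Union>D) = card g" using join eq card_edge[OF gE] by simp
      then have "g \<inter> \<Union>D = g" using finite_edge[OF gE] by (intro card_subset_eq) auto
      then show False using e'(2) e'(3)[OF g] by blast
    qed
    ultimately show ?thesis by blast
  qed
qed

lemma connected_bound:
  assumes "E \<noteq> {}" "\<not> disconnected E"
  shows "s * card E \<le> (s + 1) * card (\<Union>E) \<and>
    (s * card E = (s + 1) * card (\<Union>E) \<longrightarrow> steiner_system_2 s (s\<^sup>2) (\<Union>E) E)"
proof (cases "\<forall>e\<in>E. \<forall>f\<in>E. e \<inter> f \<noteq> {}")
  case True
  then have "s * card E < (s + 1) * card (\<Union>E)"
    using assms(1) by (intro intersecting_less) auto
  then show ?thesis by linarith
next
  case False
  then obtain e1 e2 where e12: "e1 \<in> E" "e2 \<in> E" "e1 \<inter> e2 = {}" by blast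
  obtain P Q S where PQS: "E = P \<union> Q \<union> S" "P \<noteq> {}" "Q \<noteq> {}" "S \<noteq> {}" "S \<inter> (P \<union> Q) = {}"
    and PQ: "\<And>p q. p \<in> P \<Longrightarrow> q \<in> Q \<Longrightarrow> p \<inter> q = {}"
    and S: "\<And>g b. g \<in> S \<Longrightarrow> b \<in> P \<union> Q \<Longrightarrow> g \<inter> b \<noteq> {}"
    by (rule cograph_split[OF order_refl assms(2) e12], rule that)
  have bound: "(\<Sum>v\<in>\<Union>X. deg E v) \<le> (s + 1) * card (\<Union>X) \<and>
    ((\<Sum>v\<in>\<Union>X. deg E v) = (s + 1) * card (\<Union>X) \<longrightarrow> pairwise disjnt X)"
    if X: "X \<noteq> {}" "Y \<noteq> {}" "X \<union> Y = P \<union> Q" "\<And>p q. p \<in> X \<Longrightarrow> q \<in> Y \<Longrightarrow> p \<inter> q = {}" for X Y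
  proof -
    have sub: "X \<subseteq> P \<union> Q" using X(3) by blast
    obtain y where y: "y \<in> Y" using X(2) by blast
    have yPQ: "y \<in> P \<union> Q" using X(3) y by blast
    show ?thesis
    proof (rule module_bound[of X S y])
      show "S \<subseteq> E" "y \<in> E" using yPQ PQS(1) by auto
      show "X \<subseteq> E" using sub PQS(1) by blast
      show "X \<noteq> {}" by fact
      show "S \<noteq> {}" by fact
      show "S \<inter> X = {}" using PQS(5) sub by blast
      show "g \<in> X \<union> S" if g: "g \<in> E" "g \<inter> \<Union>X \<noteq> {}" for g
      proof -
        have "g \<notin> Y" using g(2) X(4) by blast
        then show ?thesis using g(1) PQS(1) X(3) by blast
      qed
      show "y \<inter> \<Union>X = {}" using X(4)[OF _ y] by blast
      show "g \<inter> f \<noteq> {}" if "g \<in> S" "f \<in> X" for g f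
        using S that sub by blast
      show "g \<inter> y \<noteq> {}" if "g \<in> S" for g
        by (rule S[OF that yPQ])
    qed
  qed
  have bP: "(\<Sum>v\<in>\<Union>P. deg E v) \<le> (s + 1) * card (\<Union>P) \<and>
    ((\<Sum>v\<in>\<Union>P. deg E v) = (s + 1) * card (\<Union>P) \<longrightarrow> pairwise disjnt P)"
    by (rule bound[OF PQS(2,3) refl PQ])
  have QP: "p \<inter> q = {}" if "p \<in> Q" "q \<in> P" for p q
    using PQ[OF that(2,1)] by (simp only: Int_commute)
  have bQ: "(\<Sum>v\<in>\<Union>Q. deg E v) \<le> (s + 1) * card (\<Union>Q) \<and>
    ((\<Sum>v\<in>\<Union>Q. deg E v) = (s + 1) * card (\<Union>Q) \<longrightarrow> pairwise disjnt Q)"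
    by (rule bound[OF PQS(3,2) Un_commute QP])
  have "(\<Sum>v\<in>\<Union>E. deg E v) \<le> (s + 1) * card (\<Union>E) \<and>
    ((\<Sum>v\<in>\<Union>E. deg E v) = (s + 1) * card (\<Union>E) \<longrightarrow>
      pairwise disjnt (P \<union> Q) \<and> \<Union>(P \<union> Q) = \<Union>E \<and> card (P \<union> Q) = s)"
    by (rule join_bound[OF order_refl PQS PQ S _ _ bP bQ, of "{}"]) auto
  then have b: "s * card E \<le> (s + 1) * card (\<Union>E)"
    "s * card E = (s + 1) * card (\<Union>E) \<Longrightarrow>
      pairwise disjnt (P \<union> Q) \<and> \<Union>(P \<union> Q) = \<Union>E \<and> card (P \<union> Q) = s"
    unfolding sum_deg_Union by auto
  moreover have "steiner_system_2 s (s\<^sup>2) (\<Union>E) E" if eq: "s * card E = (s + 1) * card (\<Union>E)"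
  proof -
    have "card (\<Union>E) = s * s"
      using card_Union_matching[of "P \<union> Q"] b(2)[OF eq] PQS(1) by auto
    then show ?thesis using eq steiner_system_if_card by simp
  qed
  ultimately show ?thesis by blast
qed

end

lemma sym_share_edge: "sym ((share_edge E)\<^sup>*)"
  by (intro sym_rtrancl) (auto simp: sym_def share_edge_def)

lemma component_closed:
  assumes "hypergraph V E" "C \<in> components V E" "e \<in> E" "e \<inter> C \<noteq> {}"
  shows "e \<subseteq> C"
proof
  fix w assume w: "w \<in> e"
  obtain x where C: "C = {y \<in> V. (x, y) \<in> (share_edge E)\<^sup>*}"
    using assms by (auto simp: components_def)
  obtain z where z: "z \<in> e" "z \<in> C" using assms by blast
  have "(z, w) \<in> share_edge E" using w z assms by (auto simp: share_edge_def)
  then have "(x, w) \<in> (share_edge E)\<^sup>*" using z C by (auto intro: rtrancl_into_rtrancl)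
  then show "w \<in> C" using C w assms by (auto simp: hypergraph_def)
qed

lemma disjoint_components: "disjoint (components V E)"
proof (rule disjointI)
  fix C D assume CD: "C \<in> components V E" "D \<in> components V E" "C \<noteq> D"
  then obtain x y where C: "C = {z \<in> V. (x, z) \<in> (share_edge E)\<^sup>*}"
    and D: "D = {z \<in> V. (y, z) \<in> (share_edge E)\<^sup>*}"
    by (auto simp: components_def)
  show "C \<inter> D = {}"
  proof (rule ccontr)
    assume "C \<inter> D \<noteq> {}"
    then obtain z where "(x, z) \<in> (share_edge E)\<^sup>*" "(y, z) \<in> (share_edge E)\<^sup>*"
      using C D by blast
    then have "(x, y) \<in> (share_edge E)\<^sup>*" "(y, x) \<in> (share_edge E)\<^sup>*"
      using sym_share_edge[of E] by (meson rtrancl_trans symD)+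
    then have "C = D" unfolding C D by (auto intro: rtrancl_trans)
    then show False using CD by simp
  qed
qed

lemma Union_components: "\<Union>(components V E) = V"
  by (auto simp: components_def)

lemma connected_edges_within:
  assumes H: "hypergraph V E" and C: "C \<in> components V E" and ne: "\<And>e. e \<in> E \<Longrightarrow> e \<noteq> {}"
  shows "\<not> disconnected (edges_within E C)"
proof
  assume disc: "disconnected (edges_within E C)"
  obtain P Q where PQ: "P \<noteq> {}" "Q \<noteq> {}" "edges_within E C = P \<union> Q"
    "\<And>p q. p \<in> P \<Longrightarrow> q \<in> Q \<Longrightarrow> p \<inter> q = {}"
    by (rule disconnectedE[OF disc], rule that)
  have sub: "e \<in> E" "e \<subseteq> C" if "e \<in> P \<union> Q" for e
    using that PQ(3) by (auto simp: edges_within_def)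
  obtain p q where pq: "p \<in> P" "q \<in> Q" using PQ by blast
  obtain x y where xy: "x \<in> p" "y \<in> q" using ne sub pq by (metis UnCI all_not_in_conv)
  obtain x0 where C0: "C = {z \<in> V. (x0, z) \<in> (share_edge E)\<^sup>*}"
    using C by (auto simp: components_def)
  have "x \<in> C" "y \<in> C" using xy pq sub by blast+
  then have "(x0, x) \<in> (share_edge E)\<^sup>*" "(x0, y) \<in> (share_edge E)\<^sup>*"
    using C0 by auto
  then have "(x, y) \<in> (share_edge E)\<^sup>*"
    using sym_share_edge[of E] by (meson rtrancl_trans symD)
  then have "y \<in> \<Union>P"
  proof (induction rule: rtrancl_induct)
    case base
    then show ?case using xy pq by blast
  next
    case (step a b)
    then obtain p' e where e: "a \<in> p'" "p' \<in> P" "e \<in> E" "a \<in> e" "b \<in> e"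
      by (auto simp: share_edge_def)
    then have "e \<subseteq> C" using component_closed[OF H C, of e] sub by blast
    then have "e \<in> P \<union> Q" using PQ(3) e by (auto simp: edges_within_def)
    then show ?case using e PQ(4) by blast
  qed
  then show False using PQ(4) pq xy by blast
qed

lemma card_edges_within_sum:
  assumes H: "hypergraph V E" and fin: "finite V" and ne: "\<And>e. e \<in> E \<Longrightarrow> e \<noteq> {}"
  shows "card E = (\<Sum>C\<in>components V E. card (edges_within E C))"
proof -
  have finC: "finite (components V E)" using fin by (simp add: components_def)
  have "E \<subseteq> Pow V" using H by (auto simp: hypergraph_def)
  then have finE: "finite E" using fin finite_subset by blast
  have "E = (\<Union>C\<in>components V E. edges_within E C)"
  proof
    show "E \<subseteq> (\<Union>C\<in>components V E. edges_within E C)"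
    proof
      fix e assume e: "e \<in> E"
      then obtain x where x: "x \<in> e" using ne by blast
      then have "x \<in> V" using H e by (auto simp: hypergraph_def)
      then obtain C where C: "C \<in> components V E" "x \<in> C"
        using Union_components[of V E] by blast
      then have "e \<subseteq> C" using component_closed[OF H C(1) e] C(2) x by blast
      then show "e \<in> (\<Union>C\<in>components V E. edges_within E C)"
        using C e by (auto simp: edges_within_def)
    qed
  qed (auto simp: edges_within_def)
  then have "card E = card (\<Union>C\<in>components V E. edges_within E C)" by simp
  also have "\<dots> = (\<Sum>C\<in>components V E. card (edges_within E C))"
  proof (intro card_UN_disjoint ballI impI)
    fix C D assume CD: "C \<in> components V E" "D \<in> components V E" "C \<noteq> D"
    then have "C \<inter> D = {}" by (rule disjointD[OF disjoint_components])
    then have "e = {}" if "e \<in> edges_within E C" "e \<in> edges_within E D" for e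
      using that by (auto simp: edges_within_def)
    then show "edges_within E C \<inter> edges_within E D = {}"
      using ne by (auto simp: edges_within_def)
  qed (use finC finE in \<open>auto simp: edges_within_def\<close>)
  finally show ?thesis .
qed

lemma component_bound:
  assumes s2: "s \<ge> 2" and fin: "finite V" and H: "hypergraph V E" and u: "uniform s E"
    and l: "linear_hypergraph E" and P: "P4_free s E" and C: "C \<in> components V E"
  shows "s * card (edges_within E C) \<le> (s + 1) * card C"
    and "s * card (edges_within E C) = (s + 1) * card C \<longleftrightarrow>
      edges_within E C \<noteq> {} \<and> steiner_system_2 s (s\<^sup>2) C (edges_within E C)"
proof -
  let ?F = "edges_within E C"
  have FE: "?F \<subseteq> E" by (auto simp: edges_within_def)
  have finE: "finite E" using H fin finite_subset[of E "Pow V"] by (auto simp: hypergraph_def)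
  have ne: "e \<noteq> {}" if "e \<in> E" for e
    using s2 that u by (auto simp: uniform_def)
  have "C \<subseteq> V" "C \<noteq> {}" using C by (auto simp: components_def)
  then have finC: "finite C" and pos: "card C > 0"
    using fin finite_subset by (auto simp: card_gt_0_iff)
  interpret F: linear_P4_free s ?F
  proof
    show "finite ?F" using FE finE by (rule finite_subset)
    show "uniform s ?F" using u FE unfolding uniform_def by blast
    show "linear_hypergraph ?F" using l FE unfolding linear_hypergraph_def by (meson subsetD)
    show "P4_free s ?F" using P FE unfolding P4_free_def by (meson order_trans)
  qed (rule s2)
  have conn: "\<not> disconnected ?F" by (rule connected_edges_within[OF H C ne])
  have sub: "\<Union>?F \<subseteq> C" by (auto simp: edges_within_def)
  then have le: "card (\<Union>?F) \<le> card C" using finC card_mono by blast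
  then have le': "(s + 1) * card (\<Union>?F) \<le> (s + 1) * card C" by (rule mult_le_mono2)
  show bound: "s * card ?F \<le> (s + 1) * card C"
  proof (cases "?F = {}")
    case False
    then show ?thesis using F.connected_bound[OF False conn] le' by linarith
  qed simp
  show "s * card ?F = (s + 1) * card C \<longleftrightarrow> ?F \<noteq> {} \<and> steiner_system_2 s (s\<^sup>2) C ?F"
  proof
    assume eq: "s * card ?F = (s + 1) * card C"
    have Fne: "?F \<noteq> {}" using eq pos by auto
    then have "(s + 1) * card (\<Union>?F) = (s + 1) * card C"
      and st: "steiner_system_2 s (s\<^sup>2) (\<Union>?F) ?F"
      using F.connected_bound[OF Fne conn] le' eq by auto
    then have "card (\<Union>?F) = card C" unfolding mult_cancel1 by simp
    then have "\<Union>?F = C" using sub finC by (intro card_subset_eq)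
    then show "?F \<noteq> {} \<and> steiner_system_2 s (s\<^sup>2) C ?F" using st Fne by simp
  next
    assume "?F \<noteq> {} \<and> steiner_system_2 s (s\<^sup>2) C ?F"
    then show "s * card ?F = (s + 1) * card C" using F.card_if_steiner_system by blast
  qed
qed

lemma no_isolated_iff:
  assumes H: "hypergraph V E" and ne: "\<And>e. e \<in> E \<Longrightarrow> e \<noteq> {}"
  shows "\<not> (\<exists>x. isolated_vertex V E x) \<longleftrightarrow> edge_components V E = components V E"
proof
  assume L: "\<not> (\<exists>x. isolated_vertex V E x)"
  have "edges_within E C \<noteq> {}" if C: "C \<in> components V E" for C
  proof -
    obtain x where x: "x \<in> C" "x \<in> V" using C by (auto simp: components_def)
    then obtain e where e: "e \<in> E" "x \<in> e" using L by (auto simp: isolated_vertex_def)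
    then have "e \<subseteq> C" using component_closed[OF H C, of e] x by blast
    then show ?thesis using e by (auto simp: edges_within_def)
  qed
  then show "edge_components V E = components V E" by (auto simp: edge_components_def)
next
  assume R: "edge_components V E = components V E"
  show "\<not> (\<exists>x. isolated_vertex V E x)"
  proof
    assume "\<exists>x. isolated_vertex V E x"
    then obtain x where x: "x \<in> V" "\<And>e. e \<in> E \<Longrightarrow> x \<notin> e" by (auto simp: isolated_vertex_def)
    have "y = x" if "(x, y) \<in> (share_edge E)\<^sup>*" for y
      using that by (cases rule: converse_rtranclE) (use x(2) in \<open>auto simp: share_edge_def\<close>)
    then have C: "{y \<in> V. (x, y) \<in> (share_edge E)\<^sup>*} = {x}" using x(1) by auto
    then have "{x} \<in> edge_components V E"
      unfolding R components_def using x(1) by (intro image_eqI[of _ _ x]) simp_all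
    then obtain e where "e \<in> E" "e \<subseteq> {x}" by (auto simp: edge_components_def edges_within_def)
    then show False using ne[of e] x(2)[of e] by blast
  qed
qed

theorem corollary2p8:
  fixes s :: nat and V :: "'a set" and E :: "'a set set"
  assumes "s \<ge> 2"
    and "finite V"
    and "hypergraph V E"
    and "uniform s E"
    and "linear_hypergraph E"
    and "P4_free s E"
  shows "real (card E) \<le> (real s + 1) / real s * real (card V) \<and>
    (real (card E) = (real s + 1) / real s * real (card V) \<longleftrightarrow>
      \<not> (\<exists>x. isolated_vertex V E x) \<and>
      pairwise disjnt (edge_components V E) \<and>
      (\<forall>C\<in>edge_components V E. steiner_system_2 s (s\<^sup>2) C (edges_within E C)))"
proof -
  let ?K = "components V E"
  have ne: "e \<noteq> {}" if "e \<in> E" for e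
    using assms(1,4) that by (auto simp: uniform_def)
  have finK: "finite ?K" using assms by (simp add: components_def)
  note comp = component_bound[OF assms]
  have E: "s * card E = (\<Sum>C\<in>?K. s * card (edges_within E C))"
    using card_edges_within_sum[OF assms(3,2) ne] by (simp add: sum_distrib_left)
  have "card V = (\<Sum>C\<in>?K. card C)"
    using card_Union_disjoint[OF disjoint_components, of V E] Union_components[of V E] assms(2)
    by (metis Sup_upper finite_subset)
  then have V: "(s + 1) * card V = (\<Sum>C\<in>?K. (s + 1) * card C)"
    by (simp add: sum_distrib_left)
  have le: "s * card E \<le> (s + 1) * card V"
    unfolding E V by (intro sum_mono comp)
  have "s * card E = (s + 1) * card V \<longleftrightarrow>
    (\<forall>C\<in>?K. s * card (edges_within E C) = (s + 1) * card C)"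
    unfolding E V using comp(1) finK by (auto intro: sum_mono_inv)
  also have "\<dots> \<longleftrightarrow> edge_components V E = ?K \<and>
    (\<forall>C\<in>edge_components V E. steiner_system_2 s (s\<^sup>2) C (edges_within E C))"
  proof -
    have "edge_components V E = ?K \<longleftrightarrow> (\<forall>C\<in>?K. edges_within E C \<noteq> {})"
      by (auto simp: edge_components_def)
    then show ?thesis using comp(2) by auto
  qed
  also have "\<dots> \<longleftrightarrow> \<not> (\<exists>x. isolated_vertex V E x) \<and> pairwise disjnt (edge_components V E) \<and>
    (\<forall>C\<in>edge_components V E. steiner_system_2 s (s\<^sup>2) C (edges_within E C))"
    using no_isolated_iff[OF assms(3) ne] disjoint_components[of V E] by auto
  finally have eq: "s * card E = (s + 1) * card V \<longleftrightarrow> \<dots>" .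
  have "real (card E) \<le> (real s + 1) / real s * real (card V) \<longleftrightarrow>
      real (s * card E) \<le> real ((s + 1) * card V)"
    and "real (card E) = (real s + 1) / real s * real (card V) \<longleftrightarrow>
      real (s * card E) = real ((s + 1) * card V)"
    using assms(1) by (auto simp: field_simps)
  then show ?thesis using le eq unfolding of_nat_le_iff of_nat_eq_iff by blast
qed

end
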